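(* The following hold: 1. There exists a competing growth process $(v_a(\tau_n))_{a\in[A],n\in\mathbb{N}_0}$ (as defined in the context) for which $0<\mathbb{P}(\text{monopoly occurs})<1$. 2. There exists a competing growth process $(v_a(\tau_n))_{a\in[A],n\in\mathbb{N}_0}$ for which $0<\mathbb{P}(\text{strict leadership occurs})<1$.
   Context: Notation: $[A]=\{1,\dots,A\}$, $\mathbb{N}=\{1,2,\dots\}$, $\mathbb{N}_0=\mathbb{N}\cup\{0\}$; empty sums are $0$. Competing growth process. Let $A\ge2$ be the number of agents. To each agent $a\in[A]$ is associated a sequence $(X^{(a)}_j)_{j\in\mathbb{N}}$ of $[0,\infty)$-valued random variables. All the variables $X^{(a)}_j$ ($a\in[A]$, $j\in\mathbb{N}$) are mutually independent, and the sequences $(X^{(a)}_j)_{j\in\mathbb{N}}$ have the same law for all $a$ (for fixed $a$, the law of $X^{(a)}_j$ may depend on $j$). Agent $a$ has a deterministic initial value $m_a\in\mathbb{N}_0$, and $X^{(a)}_k$ is the time taken for the value of $a$ to increase from $k-1$ to $k$. That is, the value $v_a(t)$ of $a$ at time $t\ge0$ satisfies, for $k\in\mathbb{N}_0$, $$v_a(t)=m_a+k \iff \sum_{j=m_a+1}^{m_a+k}X^{(a)}_j\le t<\sum_{j=m_a+1}^{m_a+k+1}X^{(a)}_j,$$ and $v_a(t)=\infty$ if $t\ge\sum_{j=m_a+1}^\infty X^{(a)}_j$. Set $\tau_0:=0$ and, for $n\in\mathbb{N}$, $\tau_n:=\inf\{t\ge0:\sum_{a=1}^A v_a(t)\ge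 n\}$. The competing growth process is $(v_a(\tau_n))_{a\in[A],n\in\mathbb{N}_0}$. It is a standing assumption that this process is $\mathbb{N}_0$-valued, i.e. almost surely $v_a(\tau_n)<\infty$ for all $a\in[A]$, $n\in\mathbb{N}_0$ (explosion, $\lim_n\tau_n<\infty$, is allowed). Strict leadership: there is $a\in[A]$ such that, for all but finitely many $n$, $v_a(\tau_n)>v_{a'}(\tau_n)$ for every $a'\ne a$. Monopoly: there is a unique $a\in[A]$ such that $\lim_{n\to\infty}v_a(\tau_n)=\infty$. *)

theory Defs
  imports "HOL-Probability.Probability"
begin

text \<open>Agents are \<open>1, \<dots>, A\<close>. For one agent with initial value \<open>m\<close>, the argument \<open>x j\<close>
  (\<open>j \<ge> 1\<close>) is the time taken to go from value \<open>j - 1\<close> to value \<open>j\<close>; \<open>x 0\<close> is never used.\<close>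

definition reach_time :: "nat \<Rightarrow> (nat \<Rightarrow> real) \<Rightarrow> nat \<Rightarrow> real" where
  "reach_time m x k = (\<Sum>j = m + 1..m + k. x j)"

definition agent_value :: "nat \<Rightarrow> (nat \<Rightarrow> real) \<Rightarrow> real \<Rightarrow> enat" where
  "agent_value m x t =
     (if \<exists>k. reach_time m x k \<le> t \<and> t < reach_time m x (k + 1)
      then enat (m + (THE k. reach_time m x k \<le> t \<and> t < reach_time m x (k + 1)))
      else \<infinity>)"

lemma reach_time_Suc: "reach_time m x (Suc k) = reach_time m x k + x (m + k + 1)"
  by (simp add: reach_time_def)

lemma reach_time_mono:
  assumes "\<And>j. j \<ge> 1 \<Longrightarrow> 0 \<le> x j" "k \<le> l"
  shows "reach_time m x k \<le> reach_time m x l"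
  using assms(2) by (induction rule: dec_induct) (use assms(1) in \<open>auto simp: reach_time_Suc intro: add_increasing2\<close>)

text \<open>The next two lemmas are the characterisation of the value by which the process is
  usually introduced.\<close>

lemma agent_value_eq_enat_iff:
  assumes nonneg: "\<And>j. j \<ge> 1 \<Longrightarrow> 0 \<le> x j"
  shows "agent_value m x t = enat (m + k) \<longleftrightarrow>
    (\<Sum>j = m + 1..m + k. x j) \<le> t \<and> t < (\<Sum>j = m + 1..m + k + 1. x j)"
proof -
  let ?P = "\<lambda>k. reach_time m x k \<le> t \<and> t < reach_time m x (k + 1)"
  have uniq: "i = l" if "?P i" "?P l" for i l
  proof (rule ccontr)
    assume "i \<noteq> l"
    then consider "i + 1 \<le> l" | "l + 1 \<le> i" by linarith
    then show False
    proof cases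
      case 1
      have "reach_time m x (i + 1) \<le> reach_time m x l"
        by (rule reach_time_mono) (use nonneg 1 in auto)
      with that show False by linarith
    next
      case 2
      have "reach_time m x (l + 1) \<le> reach_time m x i"
        by (rule reach_time_mono) (use nonneg 2 in auto)
      with that show False by linarith
    qed
  qed
  have the: "(THE k. ?P k) = i" if "?P i" for i
    by (rule the_equality[where P = ?P, OF that uniq[OF _ that]])
  have "agent_value m x t = enat (m + k) \<longleftrightarrow> ?P k"
  proof (cases "\<exists>i. ?P i")
    case True
    then obtain i where i: "?P i" by blast
    have "agent_value m x t = enat (m + i)"
      unfolding agent_value_def the[OF i] if_P[OF True] ..
    then have "agent_value m x t = enat (m + k) \<longleftrightarrow> i = k" by simp
    also have "\<dots> \<longleftrightarrow> ?P k" using i uniq[OF i] by blast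
    finally show ?thesis .
  next
    case False
    then have "agent_value m x t = \<infinity>"
      unfolding agent_value_def by (rule if_not_P)
    with False show ?thesis by simp
  qed
  then show ?thesis by (simp add: reach_time_def)
qed

lemma agent_value_eq_infinity_iff:
  assumes nonneg: "\<And>j. j \<ge> 1 \<Longrightarrow> 0 \<le> x j" and t: "0 \<le> t"
  shows "agent_value m x t = \<infinity> \<longleftrightarrow> (\<Sum>j. ennreal (x (m + 1 + j))) \<le> ennreal t"
proof -
  have part: "(\<Sum>j<k. ennreal (x (m + 1 + j))) = ennreal (reach_time m x k)" for k
  proof -
    have "reach_time m x k = (\<Sum>j<k. x (m + 1 + j))"
      by (induction k) (simp_all add: reach_time_Suc, simp add: reach_time_def)
    then show ?thesis by (simp add: sum_ennreal nonneg)
  qed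
  have "agent_value m x t = \<infinity> \<longleftrightarrow>
      \<not> (\<exists>k. reach_time m x k \<le> t \<and> t < reach_time m x (k + 1))"
    unfolding agent_value_def by (simp del: not_ex)
  also have "\<dots> \<longleftrightarrow> (\<forall>k. reach_time m x k \<le> t \<longrightarrow> reach_time m x (Suc k) \<le> t)"
    by (simp add: not_less)
  also have "\<dots> \<longleftrightarrow> (\<forall>k. reach_time m x k \<le> t)"
  proof
    assume step: "\<forall>k. reach_time m x k \<le> t \<longrightarrow> reach_time m x (Suc k) \<le> t"
    show "\<forall>k. reach_time m x k \<le> t"
    proof
      fix k show "reach_time m x k \<le> t"
        by (induction k) (use step t in \<open>auto simp: reach_time_def\<close>)
    qed
  qed auto
  also have "\<dots> \<longleftrightarrow> (\<forall>k. (\<Sum>j<k. ennreal (x (m + 1 + j))) \<le> ennreal t)"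
    unfolding part using t by simp
  also have "\<dots> \<longleftrightarrow> (\<Sum>j. ennreal (x (m + 1 + j))) \<le> ennreal t"
    by (simp add: suminf_eq_SUP SUP_le_iff)
  finally show ?thesis .
qed

text \<open>In the following, \<open>x a j\<close> is a realisation of all growth times. For nonnegative \<open>x\<close>
  and \<open>A \<ge> 1\<close> the set in \<open>total_time\<close> is nonempty and bounded below, so the infimum is
  the true one.\<close>

definition total_time :: "nat \<Rightarrow> (nat \<Rightarrow> nat) \<Rightarrow> (nat \<Rightarrow> nat \<Rightarrow> real) \<Rightarrow> nat \<Rightarrow> real" where
  "total_time A m x n =
     (if n = 0 then 0
      else Inf {t. 0 \<le> t \<and> enat n \<le> (\<Sum>a = 1..A. agent_value (m a) (x a) t)})"

definition growth_process ::
    "nat \<Rightarrow> (nat \<Rightarrow> nat) \<Rightarrow> (nat \<Rightarrow> nat \<Rightarrow> real) \<Rightarrow> nat \<Rightarrow> nat \<Rightarrow> enat" where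
  "growth_process A m x a n = agent_value (m a) (x a) (total_time A m x n)"

definition strict_leadership ::
    "nat \<Rightarrow> (nat \<Rightarrow> nat) \<Rightarrow> (nat \<Rightarrow> nat \<Rightarrow> real) \<Rightarrow> bool" where
  "strict_leadership A m x \<longleftrightarrow>
     (\<exists>a\<in>{1..A}. \<forall>\<^sub>F n in sequentially. \<forall>a'\<in>{1..A}. a' \<noteq> a \<longrightarrow>
        growth_process A m x a n > growth_process A m x a' n)"

definition monopoly :: "nat \<Rightarrow> (nat \<Rightarrow> nat) \<Rightarrow> (nat \<Rightarrow> nat \<Rightarrow> real) \<Rightarrow> bool" where
  "monopoly A m x \<longleftrightarrow>
     (\<exists>!a. a \<in> {1..A} \<and> (\<lambda>n. growth_process A m x a n) \<longlonglongrightarrow> \<infinity>)"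

text \<open>\<open>X a j\<close> matters only for \<open>a \<in> {1..A}\<close> and \<open>j \<ge> 1\<close>.\<close>

locale competing_growth = prob_space M for M :: "'w measure" +
  fixes A :: nat
    and m :: "nat \<Rightarrow> nat"
    and X :: "nat \<Rightarrow> nat \<Rightarrow> 'w \<Rightarrow> real"
  assumes agents: "A \<ge> 2"
    and nonneg: "\<And>a j \<omega>. a \<in> {1..A} \<Longrightarrow> j \<ge> 1 \<Longrightarrow> \<omega> \<in> space M \<Longrightarrow> 0 \<le> X a j \<omega>"
    and indep: "indep_vars (\<lambda>_. borel) (\<lambda>(a, j). X a j) ({1..A} \<times> {1..})"
    and same_law: "\<And>a a'. a \<in> {1..A} \<Longrightarrow> a' \<in> {1..A} \<Longrightarrow>
      distr M (Pi\<^sub>M {1..} (\<lambda>_. borel)) (\<lambda>\<omega>. \<lambda>j\<in>{1..}. X a j \<omega>) =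
      distr M (Pi\<^sub>M {1..} (\<lambda>_. borel)) (\<lambda>\<omega>. \<lambda>j\<in>{1..}. X a' j \<omega>)"
    and finite_values: "AE \<omega> in M. \<forall>a\<in>{1..A}. \<forall>n.
      growth_process A m (\<lambda>a j. X a j \<omega>) a n < \<infinity>"

end

theory Submission
  imports Defs
begin

text \<open>One construction serves both parts. Two agents start at 0; the first growth time is
  \<open>1/2 + c\<close>, where \<open>c \<in> {0, 1}\<close> is a fair coin, and the \<open>j\<close>-th one is \<open>2\<^sup>-\<^sup>j\<close> for \<open>j \<ge> 2\<close>.
  If the coins differ, the agent with \<open>c = 0\<close> explodes at time 1, before the other one makes its
  first step at time \<open>3/2\<close>, and has both a monopoly and the strict leadership. If the coins agree,
  both agents have the same value at all times, so that neither event occurs. Each case has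
  probability \<open>1/2\<close>.\<close>

section \<open>Values and reaching times as inverse functions\<close>

text \<open>This turns the set behind \<open>total_time\<close> into a condition on reaching times.
  It covers the value \<open>\<infinity>\<close>: if no interval between successive reaching times
  contains \<open>t\<close>, induction pushes all of them below \<open>t\<close>.\<close>

lemma le_agent_value_iff:
  assumes nonneg: "\<And>j. j \<ge> 1 \<Longrightarrow> 0 \<le> x j" and t: "0 \<le> t"
  shows "enat (m + k) \<le> agent_value m x t \<longleftrightarrow> reach_time m x k \<le> t"
proof (cases "\<exists>i. reach_time m x i \<le> t \<and> t < reach_time m x (i + 1)")
  case True
  then obtain i where i: "reach_time m x i \<le> t" "t < reach_time m x (i + 1)" by blast
  then have v: "agent_value m x t = enat (m + i)"
    using agent_value_eq_enat_iff[of x m t i] nonneg by (simp add: reach_time_def)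
  have "k \<le> i \<longleftrightarrow> reach_time m x k \<le> t"
  proof
    assume "k \<le> i"
    then show "reach_time m x k \<le> t"
      using reach_time_mono[of x k i m] nonneg i by fastforce
  next
    assume "reach_time m x k \<le> t"
    then show "k \<le> i"
      using reach_time_mono[of x "i + 1" k m] nonneg i by (fastforce simp: not_le)
  qed
  with v show ?thesis by simp
next
  case False
  then have "agent_value m x t = \<infinity>" unfolding agent_value_def by (rule if_not_P)
  moreover have "reach_time m x k \<le> t"
  proof (induction k)
    case 0
    then show ?case using t by (simp add: reach_time_def)
  next
    case (Suc k)
    then show ?case using False by (auto simp: not_less)
  qed
  ultimately show ?thesis by simp
qed

text \<open>Positivity makes the interval starting at the \<open>k\<close>-th reaching time
  nonempty; a zero growth time would let the value jump past \<open>m + k\<close>.\<close>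

lemma agent_value_reach_time:
  assumes "\<And>j. j \<ge> 1 \<Longrightarrow> 0 < x j"
  shows "agent_value m x (reach_time m x k) = enat (m + k)"
proof -
  have "reach_time m x k < reach_time m x (Suc k)"
    using assms by (simp add: reach_time_Suc)
  then show ?thesis
    using agent_value_eq_enat_iff[of x m "reach_time m x k" k] assms
    by (fastforce simp: reach_time_def less_imp_le)
qed

section \<open>Geometric growth times with a delayed first step\<close>

definition delayed_times :: "real \<Rightarrow> nat \<Rightarrow> real" where
  "delayed_times c j = (1 / 2) ^ j + (if j = 1 then c else 0)"

lemma delayed_times_pos: "0 \<le> c \<Longrightarrow> 0 < delayed_times c j"
  by (simp add: delayed_times_def add_pos_nonneg)

text \<open>Geometric sum. The delay enters with the first step and stays, hence the exception at
  \<open>k = 0\<close>; the explosion time is \<open>1 + c\<close>.\<close>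

lemma reach_time_delayed:
  "reach_time 0 (delayed_times c) k = 1 - (1 / 2) ^ k + (if k = 0 then 0 else c)"
  by (induction k) (simp_all add: reach_time_Suc delayed_times_def, simp add: reach_time_def)

lemma reach_time_delayed_nonneg:
  "0 \<le> c \<Longrightarrow> 0 \<le> reach_time 0 (delayed_times c) k"
  by (simp add: reach_time_delayed power_le_one)

lemma le_agent_value_delayed_iff:
  assumes "0 \<le> c" "0 \<le> t"
  shows "enat k \<le> agent_value 0 (delayed_times c) t \<longleftrightarrow> reach_time 0 (delayed_times c) k \<le> t"
  using le_agent_value_iff[of "delayed_times c" t 0 k] delayed_times_pos[OF assms(1)] assms(2)
  by (simp add: less_imp_le)

lemma agent_value_reach_time_delayed:
  "0 \<le> c \<Longrightarrow> agent_value 0 (delayed_times c) (reach_time 0 (delayed_times c) k) = enat k"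
  using agent_value_reach_time[of "delayed_times c" 0 k] delayed_times_pos by simp

section \<open>The process of two agents with given delays\<close>

lemma total_time_eqI:
  assumes "n = 0 \<Longrightarrow> T = 0" "0 \<le> T"
    and "\<And>t. 0 \<le> t \<Longrightarrow> enat n \<le> (\<Sum>a = 1..A. agent_value (m a) (x a) t) \<longleftrightarrow> T \<le> t"
  shows "total_time A m x n = T"
proof -
  have "{t. 0 \<le> t \<and> enat n \<le> (\<Sum>a = 1..A. agent_value (m a) (x a) t)} = {T..}"
    using assms(2,3) by fastforce
  then show ?thesis using assms(1) by (simp add: total_time_def)
qed

lemma sum_agents_2: "(\<Sum>a = 1..2. f a) = f 1 + f (2::nat)"
  by (simp add: numeral_2_eq_2)

text \<open>Both agents step simultaneously, so the total value grows by 2 at a time and reaches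
  \<open>n\<close> once each agent has half of \<open>n\<close>, rounded up.\<close>

lemma growth_process_equal_delays:
  assumes "0 \<le> c" "x 1 = delayed_times c" "x 2 = delayed_times c" "a \<in> {1..2}"
  shows "growth_process 2 (\<lambda>_. 0) x a n = enat ((n + 1) div 2)"
proof -
  let ?k = "(n + 1) div 2"
  have half: "enat n \<le> v + v \<longleftrightarrow> enat ?k \<le> v" for v
    by (cases v) auto
  have "total_time 2 (\<lambda>_. 0) x n = reach_time 0 (delayed_times c) ?k"
  proof (rule total_time_eqI)
    show "n = 0 \<Longrightarrow> reach_time 0 (delayed_times c) ?k = 0" by (simp add: reach_time_delayed)
    show "0 \<le> reach_time 0 (delayed_times c) ?k" by (rule reach_time_delayed_nonneg) fact
  qed (use assms in \<open>simp add: sum_agents_2 half le_agent_value_delayed_iff del: One_nat_def\<close>)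
  moreover have "x a = delayed_times c"
    using assms by (cases "a = 1") (auto simp: le_Suc_eq numeral_2_eq_2)
  ultimately show ?thesis
    by (simp add: growth_process_def agent_value_reach_time_delayed assms(1))
qed

text \<open>Every level \<open>n\<close> of the total value is reached before time 1 by agent
  \<open>a\<close> alone, since the first step of \<open>b\<close> comes at time
  \<open>1/2 + 1 = 3/2\<close>.\<close>

lemma growth_process_distinct_delays:
  assumes x: "x a = delayed_times 0" "x b = delayed_times 1"
    and ab: "a \<in> {1..2}" "b \<in> {1..2}" "a \<noteq> b"
  shows "growth_process 2 (\<lambda>_. 0) x a n = enat n"
    and "growth_process 2 (\<lambda>_. 0) x b n = 0"
proof -
  have zero: "agent_value 0 (x b) t = 0" if "0 \<le> t" "t < 3 / 2" for t
    using le_agent_value_delayed_iff[of 1 t 1] that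
    by (cases "agent_value 0 (x b) t") (auto simp: x reach_time_delayed zero_enat_def)
  have "enat n \<le> agent_value 0 (x a) t + agent_value 0 (x b) t \<longleftrightarrow>
      reach_time 0 (x a) n \<le> t" if t: "0 \<le> t" for t
  \<comment> \<open>Before \<open>3/2\<close> only \<open>a\<close> contributes. From then on both
    sides are true, because every reaching time of \<open>a\<close> is at most 1.\<close>
  proof (cases "t < 3 / 2")
    case True
    with t show ?thesis by (simp add: zero) (simp add: x le_agent_value_delayed_iff)
  next
    case False
    moreover have "0 \<le> (1 / 2 :: real) ^ n" by simp
    ultimately have "1 - (1 / 2) ^ n \<le> t" by linarith
    then have "reach_time 0 (x a) n \<le> t"
      by (simp add: x reach_time_delayed)
    moreover from this have "enat n \<le> agent_value 0 (x a) t"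
      using t by (simp add: x le_agent_value_delayed_iff)
    ultimately show ?thesis by (simp add: add_increasing2)
  qed
  moreover have "(\<Sum>i = 1..2. f i) = f a + f b" for f :: "nat \<Rightarrow> enat"
    using ab by (cases "a = 1") (auto simp: sum_agents_2 le_Suc_eq numeral_2_eq_2 add.commute)
  ultimately have T: "total_time 2 (\<lambda>_. 0) x n = reach_time 0 (x a) n"
    by (intro total_time_eqI) (simp_all add: x reach_time_delayed power_le_one)
  then show "growth_process 2 (\<lambda>_. 0) x a n = enat n"
    by (simp add: growth_process_def x agent_value_reach_time_delayed)
  have "0 \<le> (1 / 2 :: real) ^ n" by simp
  then have "1 - (1 / 2 :: real) ^ n < 3 / 2" by linarith
  then have "reach_time 0 (x a) n < 3 / 2" "0 \<le> reach_time 0 (x a) n"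
    by (simp_all only: x reach_time_delayed_nonneg order_refl) (simp add: reach_time_delayed)
  then show "growth_process 2 (\<lambda>_. 0) x b n = 0"
    by (simp add: growth_process_def T zero)
qed

section \<open>Monopoly and strict leadership for a fixed outcome of the coins\<close>

lemma tendsto_enat_infinity:
  assumes "filterlim f at_top sequentially"
  shows "(\<lambda>n. enat (f n)) \<longlonglongrightarrow> \<infinity>"
proof (rule order_tendstoI)
  fix y :: enat assume "y < \<infinity>"
  then obtain k where "y = enat k" by (cases y) auto
  then show "\<forall>\<^sub>F n in sequentially. y < enat (f n)"
    using assms by (simp add: filterlim_at_top Suc_le_eq[symmetric] del: Suc_le_eq)
qed simp

text \<open>In the second case \<open>a\<close> is the faster agent and \<open>b\<close> the slower
  one, so that the two orders of the agents need only one argument.\<close>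

lemma delays_cases:
  fixes c :: "nat \<Rightarrow> real"
  assumes "c 1 \<in> {0, 1}" "c 2 \<in> {0, 1}"
  obtains (equal) "c 1 = c 2"
    | (distinct) a b where "a \<in> {1..2}" "b \<in> {1..2}" "a \<noteq> b" "\<And>i. i \<in> {1..2} \<Longrightarrow> i = a \<or> i = b" "c a = 0" "c b = 1"
proof -
  have two: "i = 1 \<or> i = 2" if "i \<in> {1..2}" for i :: nat using that by auto
  consider "c 1 = c 2" | "c 1 = 0" "c 2 = 1" | "c 2 = 0" "c 1 = 1"
    using assms by auto
  then show ?thesis
    by cases (use equal distinct[of 1 2] distinct[of 2 1] two in auto)
qed

context
  fixes x :: "nat \<Rightarrow> nat \<Rightarrow> real" and c :: "nat \<Rightarrow> real"
  assumes x: "\<And>a. a \<in> {1..2} \<Longrightarrow> x a = delayed_times (c a)"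
    and c: "c 1 \<in> {0, 1}" "c 2 \<in> {0, 1}"
begin

lemma growth_process_delayed_finite:
  assumes "a \<in> {1..2}"
  shows "growth_process 2 (\<lambda>_. 0) x a n < \<infinity>"
  using c
proof (cases rule: delays_cases)
  case equal
  then show ?thesis
    using growth_process_equal_delays[of "c 1" x a n] x[of 1] x[of 2] c assms by auto
next
  case (distinct f s)
  then show ?thesis
    using growth_process_distinct_delays[of x f s n] x[of f] x[of s] assms
    by (auto simp: zero_enat_def)
qed

text \<open>Equal delays send both agents to infinity, which destroys uniqueness; with distinct
  delays the slower agent stays at 0.\<close>

lemma monopoly_delayed_iff: "monopoly 2 (\<lambda>_. 0) x \<longleftrightarrow> c 1 \<noteq> c 2"
  using c
proof (cases rule: delays_cases)
  case equal
  have "filterlim (\<lambda>n::nat. (n + 1) div 2) at_top sequentially"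
    unfolding filterlim_at_top eventually_sequentially
  proof
    fix k :: nat
    show "\<exists>N. \<forall>n\<ge>N. k \<le> (n + 1) div 2" by (rule exI[of _ "2 * k"]) auto
  qed
  then have lim: "(\<lambda>n::nat. enat ((n + 1) div 2)) \<longlonglongrightarrow> \<infinity>"
    by (rule tendsto_enat_infinity)
  have "(\<lambda>n. growth_process 2 (\<lambda>_. 0) x a n) = (\<lambda>n. enat ((n + 1) div 2))" if "a \<in> {1..2}" for a
    by (intro ext growth_process_equal_delays[of "c 1"]) (use c x that equal in auto)
  with lim have "(\<lambda>n. growth_process 2 (\<lambda>_. 0) x a n) \<longlonglongrightarrow> \<infinity>" if "a \<in> {1..2}" for a
    using that by simp
  moreover have "1 \<in> {1..2::nat}" "2 \<in> {1..2::nat}" "1 \<noteq> (2::nat)" by auto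
  ultimately have "\<not> monopoly 2 (\<lambda>_. 0) x"
    unfolding monopoly_def by blast
  with equal show ?thesis by simp
next
  case (distinct f s)
  have g: "growth_process 2 (\<lambda>_. 0) x f n = enat n" "growth_process 2 (\<lambda>_. 0) x s n = 0" for n
    using growth_process_distinct_delays[of x f s n] x[of f] x[of s] distinct by auto
  have "monopoly 2 (\<lambda>_. 0) x"
    unfolding monopoly_def
  proof (rule ex1I[of _ f])
    show "f \<in> {1..2} \<and> (\<lambda>n. growth_process 2 (\<lambda>_. 0) x f n) \<longlonglongrightarrow> \<infinity>"
      using distinct by (auto simp: g intro!: tendsto_enat_infinity filterlim_ident)
  next
    fix a assume a: "a \<in> {1..2} \<and> (\<lambda>n. growth_process 2 (\<lambda>_. 0) x a n) \<longlonglongrightarrow> \<infinity>"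
    have "\<not> (\<lambda>n. growth_process 2 (\<lambda>_. 0) x s n) \<longlonglongrightarrow> \<infinity>"
      by (simp add: g LIMSEQ_const_iff)
    with a distinct show "a = f" by auto
  qed
  moreover have "c 1 \<noteq> c 2"
    using distinct(1,2,5,6) distinct(4)[of 1] distinct(4)[of 2] distinct(3) by auto
  ultimately show ?thesis by simp
qed

lemma strict_leadership_delayed_iff: "strict_leadership 2 (\<lambda>_. 0) x \<longleftrightarrow> c 1 \<noteq> c 2"
  using c
proof (cases rule: delays_cases)
  case equal
  have g: "growth_process 2 (\<lambda>_. 0) x a n = enat ((n + 1) div 2)" if "a \<in> {1..2}" for a n
    by (intro growth_process_equal_delays[of "c 1"]) (use c x that equal in auto)
  have "\<not> strict_leadership 2 (\<lambda>_. 0) x"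
  proof
    assume "strict_leadership 2 (\<lambda>_. 0) x"
    then obtain a where a: "a \<in> {1..2}" and lead: "\<forall>\<^sub>F n in sequentially. \<forall>a'\<in>{1..2}. a' \<noteq> a \<longrightarrow>
        growth_process 2 (\<lambda>_. 0) x a n > growth_process 2 (\<lambda>_. 0) x a' n"
      unfolding strict_leadership_def by blast
    \<comment> \<open>\<open>3 - a\<close> is the opponent of \<open>a\<close>. Its value equals
      that of \<open>a\<close> for every \<open>n\<close>, so it is never strictly beaten.\<close>
    have "3 - a \<in> {1..2}" "3 - a \<noteq> a" using a by auto presburger
    with lead have "\<forall>\<^sub>F n in sequentially.
        growth_process 2 (\<lambda>_. 0) x a n > growth_process 2 (\<lambda>_. 0) x (3 - a) n"
      by (auto elim: eventually_mono)
    then show False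
      unfolding g[OF a] g[OF \<open>3 - a \<in> {1..2}\<close>] by simp
  qed
  with equal show ?thesis by simp
next
  case (distinct f s)
  have g: "growth_process 2 (\<lambda>_. 0) x f n = enat n" "growth_process 2 (\<lambda>_. 0) x s n = 0" for n
    using growth_process_distinct_delays[of x f s n] x[of f] x[of s] distinct by auto
  have "\<forall>\<^sub>F n in sequentially. \<forall>a'\<in>{1..2}. a' \<noteq> f \<longrightarrow>
      growth_process 2 (\<lambda>_. 0) x f n > growth_process 2 (\<lambda>_. 0) x a' n"
    \<comment> \<open>At \<open>n = 0\<close> both agents are at 0; the lead starts with
      \<open>n = 1\<close>.\<close>
    using eventually_gt_at_top[of 0]
  proof eventually_elim
    case (elim n)
    then show ?case using distinct(4) by (metis g enat_ord_simps(2) zero_enat_def)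
  qed
  then have "strict_leadership 2 (\<lambda>_. 0) x"
    unfolding strict_leadership_def using distinct by blast
  moreover have "c 1 \<noteq> c 2"
    using distinct(1,2,5,6) distinct(4)[of 1] distinct(4)[of 2] distinct(3) by auto
  ultimately show ?thesis by simp
qed

end

section \<open>The probability space of independent coins\<close>

text \<open>The joint law of the coordinates is the product measure itself, and so is the product of
  their marginals; equality of the two is independence.\<close>

lemma indep_vars_PiM_component:
  assumes "\<And>i. i \<in> I \<Longrightarrow> prob_space (M i)" "I \<noteq> {}"
  shows "prob_space.indep_vars (PiM I M) M (\<lambda>i \<omega>. \<omega> i) I"
proof -
  interpret prob_space "PiM I M" by (intro prob_space_PiM assms)
  \<comment> \<open>Points of the product space are extensional, so restricting them to
    \<open>I\<close> changes nothing.\<close>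
  have "distr (PiM I M) (PiM I M) (\<lambda>\<omega>. \<lambda>i\<in>I. \<omega> i) = distr (PiM I M) (PiM I M) (\<lambda>\<omega>. \<omega>)"
    by (intro distr_cong) (auto simp: space_PiM PiE_def)
  also have "\<dots> = (\<Pi>\<^sub>M i\<in>I. distr (PiM I M) (M i) (\<lambda>\<omega>. \<omega> i))"
    by (simp add: distr_id distr_PiM_component assms cong: PiM_cong)
  finally show ?thesis
    by (subst indep_vars_iff_distr_eq_PiM') (use assms in auto)
qed

definition coin :: "real measure" where
  "coin = measure_pmf (pmf_of_set {0, 1})"

text \<open>With one coin per pair of agent and index, each growth time is a function of its own
  coordinate and inherits independence from the coordinates.\<close>

definition coins :: "(nat \<times> nat \<Rightarrow> real) measure" where
  "coins = (\<Pi>\<^sub>M i\<in>{1..2} \<times> {1..}. coin)"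

text \<open>The sample space of \<open>coin\<close> is the whole real line. Rounding to 0 or 1 makes
  every outcome, not just almost every one, fall under the deterministic analysis.\<close>

definition coin_delay :: "real \<Rightarrow> real" where
  "coin_delay y = (if y = 0 then 0 else 1)"

definition delay :: "nat \<Rightarrow> (nat \<times> nat \<Rightarrow> real) \<Rightarrow> real" where
  "delay a \<omega> = coin_delay (\<omega> (a, 1))"

lemma coin_delay_nonneg: "0 \<le> coin_delay y"
  by (simp add: coin_delay_def)

lemma delay_in: "delay a \<omega> \<in> {0, 1}"
  by (simp add: delay_def coin_delay_def)

definition coin_time :: "nat \<Rightarrow> real \<Rightarrow> real" where
  "coin_time j y = delayed_times (coin_delay y) j"

definition coin_times :: "nat \<Rightarrow> nat \<Rightarrow> (nat \<times> nat \<Rightarrow> real) \<Rightarrow> real" where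
  "coin_times a j \<omega> = coin_time j (\<omega> (a, j))"

text \<open>\<open>delayed_times\<close> depends on its delay at \<open>j = 1\<close> only, and
  there \<open>coin_time\<close> reads the same coordinate \<open>(a, 1)\<close> as
  \<open>delay\<close>.\<close>

lemma coin_times_eq: "(\<lambda>j. coin_times a j \<omega>) = delayed_times (delay a \<omega>)"
  by (auto simp: coin_times_def coin_time_def delayed_times_def delay_def)

lemma prob_space_coin: "prob_space coin"
  by (simp add: coin_def measure_pmf.prob_space_axioms)

lemma prob_space_coins: "prob_space coins"
  by (simp add: coins_def prob_space_PiM prob_space_coin)

text \<open>\<open>coin\<close> carries the discrete sigma-algebra.\<close>

lemma measurable_coin: "f \<in> measurable coin borel"
  by (simp add: coin_def)

lemma indep_coin_times:
  "prob_space.indep_vars coins (\<lambda>_. borel) (\<lambda>(a, j). coin_times a j) ({1..2} \<times> {1..})"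
proof -
  interpret prob_space coins by (rule prob_space_coins)
  have "indep_vars (\<lambda>_. coin) (\<lambda>i \<omega>. \<omega> i) ({1..2} \<times> {1..})"
    unfolding coins_def by (rule indep_vars_PiM_component) (auto simp: prob_space_coin)
  then have "indep_vars (\<lambda>_. borel) (\<lambda>i \<omega>. coin_time (snd i) (\<omega> i)) ({1..2} \<times> {1..})"
    by (rule indep_vars_compose2) (rule measurable_coin)
  then show ?thesis
    by (simp add: coin_times_def[abs_def] case_prod_beta')
qed

text \<open>The right-hand side is free of \<open>a\<close>, so all agents have the same
  law.\<close>

lemma distr_coin_times:
  assumes "a \<in> {1..2}"
  shows "distr coins (Pi\<^sub>M {1..} (\<lambda>_. borel)) (\<lambda>\<omega>. \<lambda>j\<in>{1..}. coin_times a j \<omega>) =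
    distr (\<Pi>\<^sub>M j\<in>{1..}. coin) (Pi\<^sub>M {1..} (\<lambda>_. borel)) (\<lambda>y. \<lambda>j\<in>{1..}. coin_time j (y j))"
    (is "?L = distr ?N ?B ?g")
proof -
  let ?row = "\<lambda>\<omega> :: nat \<times> nat \<Rightarrow> real. \<lambda>j\<in>{1..}. \<omega> (a, j)"
  have g: "?g \<in> measurable ?N ?B"
    by (intro measurable_restrict measurable_compose[of _ _ coin, OF _ measurable_coin]
        measurable_component_singleton)
  have row: "?row \<in> measurable coins ?N"
    unfolding coins_def using assms
    by (intro measurable_restrict measurable_component_singleton) auto
  \<comment> \<open>Row \<open>a\<close> of the array of coins is a reindexing along the injection
    \<open>Pair a\<close>, which maps the product measure to a product of coins.\<close>
  have "distr coins ?N ?row = ?N"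
    unfolding coins_def using assms
    by (intro distr_PiM_reindex[where f = "Pair a" and M = "\<lambda>_. coin"])
       (auto simp: prob_space_coin inj_on_def)
  then have "distr ?N ?B ?g = distr (distr coins ?N ?row) ?B ?g" by simp
  also have "\<dots> = ?L"
    by (subst distr_distr[OF g row])
       (auto simp: comp_def coin_times_def restrict_def intro!: distr_cong)
  finally show ?thesis ..
qed

lemma competing_growth_coin_times: "competing_growth coins 2 (\<lambda>_. 0) coin_times"
proof -
  interpret prob_space coins by (rule prob_space_coins)
  show ?thesis
  proof
    show "AE \<omega> in coins. \<forall>a\<in>{1..2}. \<forall>n.
        growth_process 2 (\<lambda>_. 0) (\<lambda>a j. coin_times a j \<omega>) a n < \<infinity>"
    proof (intro AE_I2 ballI allI)
      fix \<omega> a n assume "a \<in> {1..2::nat}"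
      then show "growth_process 2 (\<lambda>_. 0) (\<lambda>a j. coin_times a j \<omega>) a n < \<infinity>"
        by (intro growth_process_delayed_finite[where c = "\<lambda>a. delay a \<omega>"])
           (simp_all only: delay_in coin_times_eq)
    qed
    show "0 \<le> coin_times a j \<omega>" for a j \<omega>
      by (simp add: coin_times_def coin_time_def less_imp_le[OF delayed_times_pos] coin_delay_nonneg)
  qed (simp_all only: order_refl indep_coin_times distr_coin_times)
qed

section \<open>Probabilities of the delays\<close>

text \<open>The event is a cylinder over the two coordinates \<open>(1, 1)\<close> and
  \<open>(2, 1)\<close>, so its measure is a product of two factors \<open>1/2\<close>.\<close>

lemma prob_delays:
  assumes "u \<in> {0, 1}" "v \<in> {0, 1}"
  shows "{\<omega> \<in> space coins. delay 1 \<omega> = u \<and> delay 2 \<omega> = v} \<in> sets coins"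
    and "\<P>(\<omega> in coins. delay 1 \<omega> = u \<and> delay 2 \<omega> = v) = 1 / 4"
proof -
  interpret product_prob_space "\<lambda>_. coin" "{1..2} \<times> {1..} :: (nat \<times> nat) set"
    by (rule product_prob_spaceI) (rule prob_space_coin)
  define J where "J = {(1, 1), (2, 1) :: nat \<times> nat}"
  define B where "B i = coin_delay -` {if i = (1::nat, 1::nat) then u else v}" for i
  have J: "J \<subseteq> {1..2} \<times> {1..}" "finite J" by (auto simp: J_def)
  have eq: "{\<omega> \<in> space coins. delay 1 \<omega> = u \<and> delay 2 \<omega> = v} =
      prod_emb ({1..2} \<times> {1..}) (\<lambda>_. coin) J (Pi\<^sub>E J B)"
  proof -
    have "restrict \<omega> J \<in> Pi\<^sub>E J B \<longleftrightarrow> delay 1 \<omega> = u \<and> delay 2 \<omega> = v" for \<omega>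
      unfolding restrict_PiE_iff by (simp add: J_def B_def delay_def)
    moreover have "prod_emb ({1..2} \<times> {1..}) (\<lambda>_. coin) J (Pi\<^sub>E J B) =
        {\<omega> \<in> space coins. restrict \<omega> J \<in> Pi\<^sub>E J B}"
      unfolding prod_emb_def coins_def space_PiM by blast
    ultimately show ?thesis by simp
  qed
  show "{\<omega> \<in> space coins. delay 1 \<omega> = u \<and> delay 2 \<omega> = v} \<in> sets coins"
    unfolding eq unfolding coins_def by (intro sets_PiM_I J) (simp add: coin_def)
  have half: "measure coin (coin_delay -` {w}) = 1 / 2" if "w \<in> {0, 1}" for w
  proof -
    \<comment> \<open>For \<open>w = 1\<close> the preimage consists of all nonzero reals; only its
      trace on the support of the coin counts.\<close>
    have "{0, 1} \<inter> coin_delay -` {w} = {w}"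
      using that by (auto simp: coin_delay_def)
    then show ?thesis by (simp add: coin_def measure_pmf_of_set)
  qed
  have "\<P>(\<omega> in coins. delay 1 \<omega> = u \<and> delay 2 \<omega> = v) = (\<Prod>i\<in>J. measure coin (B i))"
    unfolding eq unfolding coins_def by (rule measure_PiM_emb[OF J]) (simp add: coin_def)
  then show "\<P>(\<omega> in coins. delay 1 \<omega> = u \<and> delay 2 \<omega> = v) = 1 / 4"
    using half[OF assms(1)] half[OF assms(2)] by (simp add: J_def B_def)
qed

text \<open>The two ways of being distinct are disjoint and have probability \<open>1/4\<close>
  each, which gives \<open>1/2\<close>.\<close>

lemma prob_distinct_delays:
  "0 < \<P>(\<omega> in coins. delay 1 \<omega> \<noteq> delay 2 \<omega>)" "\<P>(\<omega> in coins. delay 1 \<omega> \<noteq> delay 2 \<omega>) < 1"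
proof -
  interpret prob_space coins by (rule prob_space_coins)
  let ?E = "\<lambda>u v. {\<omega> \<in> space coins. delay 1 \<omega> = u \<and> delay 2 \<omega> = v}"
  have eq: "{\<omega> \<in> space coins. delay 1 \<omega> \<noteq> delay 2 \<omega>} = ?E 0 1 \<union> ?E 1 0"
    by (auto simp: delay_def coin_delay_def)
  have "\<P>(\<omega> in coins. delay 1 \<omega> \<noteq> delay 2 \<omega>) = prob (?E 0 1) + prob (?E 1 0)"
    unfolding eq by (intro finite_measure_Union prob_delays) auto
  then show "0 < \<P>(\<omega> in coins. delay 1 \<omega> \<noteq> delay 2 \<omega>)" "\<P>(\<omega> in coins. delay 1 \<omega> \<noteq> delay 2 \<omega>) < 1"
    using prob_delays(2)[of 0 1] prob_delays(2)[of 1 0] by simp_all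
qed

theorem proposition2p1:
  "(\<exists>(M :: (nat \<times> nat \<Rightarrow> real) measure) A m X.
      competing_growth M A m X \<and>
      0 < \<P>(\<omega> in M. monopoly A m (\<lambda>a j. X a j \<omega>)) \<and>
      \<P>(\<omega> in M. monopoly A m (\<lambda>a j. X a j \<omega>)) < 1) \<and>
   (\<exists>(M :: (nat \<times> nat \<Rightarrow> real) measure) A m X.
      competing_growth M A m X \<and>
      0 < \<P>(\<omega> in M. strict_leadership A m (\<lambda>a j. X a j \<omega>)) \<and>
      \<P>(\<omega> in M. strict_leadership A m (\<lambda>a j. X a j \<omega>)) < 1)"
proof -
  \<comment> \<open>Both events are the same set of outcomes, so one witness and one probability
    settle both halves.\<close>
  have "monopoly 2 (\<lambda>_. 0) (\<lambda>a j. coin_times a j \<omega>) \<longleftrightarrow> delay 1 \<omega> \<noteq> delay 2 \<omega>"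
    and "strict_leadership 2 (\<lambda>_. 0) (\<lambda>a j. coin_times a j \<omega>) \<longleftrightarrow> delay 1 \<omega> \<noteq> delay 2 \<omega>" for \<omega>
    by (rule monopoly_delayed_iff strict_leadership_delayed_iff; simp only: coin_times_eq delay_in)+
  then show ?thesis
    using competing_growth_coin_times prob_distinct_delays
    by (intro conjI exI[of _ coins] exI[of _ 2] exI[of _ "\<lambda>_. 0"] exI[of _ coin_times]) simp_all
qed

end
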